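(* Let $X=\{-1,+1\}$, let $T(s)=X$ for both $s\in X$, and let $\psi(s,t)=st$. For $\beta\ge0$ define, for $\gamma\in\mathcal{M}(X^2)$, $\mathcal{E}_\beta(\gamma)=\frac\beta2\bigl(\int_{X^2}st\,d\gamma(s,t)\bigr)^2$. Then the nonlinear equilibrium pairs are as follows. (i) If $0\le\beta\le1$, the equilibrium pair is unique and $\mu_0(s)=\frac12$, $Q_0(s,t)=\frac12$, $\gamma_0(s,t)=\frac14$ (its two-coordinate distribution). (ii) If $\beta>1$, let $m_\beta\in(0,1)$ be the positive solution of $m_\beta=\tanh(\beta m_\beta)$. There are exactly two equilibrium pairs, indexed by $\sigma\in\{-1,+1\}$, which with their two-coordinate distributions are $$\mu_\beta^\sigma(s)=\frac12,\qquad Q_\beta^\sigma(s,t)=\frac{1+\sigma m_\beta st}{2},\qquad\gamma_\beta^\sigma(s,t)=\frac{1+\sigma m_\beta st}{4},$$ and their correlations between successive states are $\int_{X^2}st\,d\gamma_\beta^\sigma(s,t)=\sigma m_\beta$. The nonlinear pressure is $$\Pi_{\mathrm{top}}^{\mathcal{E}_\beta}(T)=\begin{cases}\log2,&0\le\beta\le1,\\ \log\bigl(2\cosh(\beta m_\beta)\bigr)-\frac\beta2m_\beta^2,&\beta>1.\end{cases}$$ For $\beta>1$, both marginals of every $\gamma_\beta^\sigma$ are uniform, but $\gamma_\beta^\sigma$ is not a product measure, and $$D\bigl(\gamma_\beta^\sigma\,\|\,\mu_\beta^\sigma\otimes\mu_\beta^\sigma\bigr)=\frac{1+m_\beta}2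\log(1+m_\beta)+\frac{1-m_\beta}2\log(1-m_\beta)>0.$$
   Context: Finite-state conventions. Let $X$ be a finite set with the discrete metric, $T$ a map assigning to each $i\in X$ a nonempty subset $T(i)\subset X$, and $\Gamma_T=\{(i,j):j\in T(i)\}$. $\mathcal{M}(\Gamma_T)$ is the set of probability vectors on $\Gamma_T$, and $\mathcal{E}:\mathcal{M}(\Gamma_T)\to\mathbb{R}$ is continuous. A stationary transition pair $(\mu,Q)$ consists of a stochastic matrix $Q=(Q(i,j))$ with $Q(i,j)=0$ for $j\notin T(i)$ and a probability vector $\mu$ with $\sum_i\mu(i)Q(i,j)=\mu(j)$. Its two-coordinate distribution is $\gamma_{\mu,Q}(i,j)=\mu(i)Q(i,j)$, and $h_\mu(Q)$ is the entropy rate of the stationary Markov chain, $h_\mu(Q)=-\sum_{i,j}\mu(i)Q(i,j)\log Q(i,j)$ ($0\log0=0$; natural logarithms). A nonlinear equilibrium pair is a stationary transition pair maximizing $h_\mu(Q)+\mathcal{E}(\gamma_{\mu,Q})$ among all stationary transition pairs. Kernels agreeing $\mu$-a.e. are identified. Nonlinear pressure: for a path $\boldsymbol{x}=(x_0,\dots,x_n)$ with $x_{j+1}\in T(x_j)$, let $L_n(\boldsymbol{x})=\frac1n\sum_{j=0}^{n-1}\delta_{(x_j,x_{j+1})}$; then $\Pi_{\mathrm{top}}^{\mathcal{E}}(T)=\lim_{n\to\infty}\frac1n\log\sum_{\boldsymbol{x}}\exp(n\mathcal{E}(L_n(\boldsymbol{x})))$, the sum over all such paths. Relative entropy of probability vectors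 on a finite set: $D(p\|q)=\sum_ip_i\log(p_i/q_i)$, with zero summands omitted and $D(p\|q)=+\infty$ if $p_i>0=q_i$ for some $i$. *)

theory Defs
  imports "HOL-Analysis.Analysis"
begin

section \<open>Nonlinear equilibrium pairs on a finite state space\<close>

text \<open>
  The finite set \<open>X\<close> is a type of class \<open>finite\<close>. An energy \<open>\<E>\<close> is a functional
  on all functions on pairs; it is only evaluated at probability vectors supported on the graph
  \<open>{(i, j). j \<in> T i}\<close>.
\<close>

definition prob_vectors :: "('b::finite \<Rightarrow> real) set" where
  "prob_vectors = {p. (\<forall>b. 0 \<le> p b) \<and> (\<Sum>b\<in>UNIV. p b) = 1}"

definition transition_kernel :: "('a::finite \<Rightarrow> 'a set) \<Rightarrow> ('a \<Rightarrow> 'a \<Rightarrow> real) \<Rightarrow> bool" where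
  "transition_kernel T Q \<longleftrightarrow>
     (\<forall>i j. 0 \<le> Q i j) \<and> (\<forall>i. (\<Sum>j\<in>UNIV. Q i j) = 1) \<and> (\<forall>i j. j \<notin> T i \<longrightarrow> Q i j = 0)"

definition stationary_pairs ::
  "('a::finite \<Rightarrow> 'a set) \<Rightarrow> (('a \<Rightarrow> real) \<times> ('a \<Rightarrow> 'a \<Rightarrow> real)) set" where
  "stationary_pairs T =
     {(\<mu>, Q). \<mu> \<in> prob_vectors \<and> transition_kernel T Q \<and>
        (\<forall>j. (\<Sum>i\<in>UNIV. \<mu> i * Q i j) = \<mu> j)}"

fun two_coord :: "('a \<Rightarrow> real) \<times> ('a \<Rightarrow> 'a \<Rightarrow> real) \<Rightarrow> 'a \<times> 'a \<Rightarrow> real" where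
  "two_coord (\<mu>, Q) (i, j) = \<mu> i * Q i j"

text \<open>The convention \<open>0 log 0 = 0\<close> holds because of the factor \<open>Q i j\<close>.\<close>

fun entropy_rate :: "('a::finite \<Rightarrow> real) \<times> ('a \<Rightarrow> 'a \<Rightarrow> real) \<Rightarrow> real" where
  "entropy_rate (\<mu>, Q) = - (\<Sum>i\<in>UNIV. \<Sum>j\<in>UNIV. \<mu> i * Q i j * ln (Q i j))"

definition nl_equilibrium_pairs ::
  "('a::finite \<Rightarrow> 'a set) \<Rightarrow> (('a \<times> 'a \<Rightarrow> real) \<Rightarrow> real) \<Rightarrow>
   (('a \<Rightarrow> real) \<times> ('a \<Rightarrow> 'a \<Rightarrow> real)) set" where
  "nl_equilibrium_pairs T \<E> =
     {p \<in> stationary_pairs T.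
        \<forall>q \<in> stationary_pairs T.
          entropy_rate q + \<E> (two_coord q) \<le> entropy_rate p + \<E> (two_coord p)}"

text \<open>Identification of kernels that agree almost everywhere with respect to \<open>\<mu>\<close>; equilibrium
  pairs are counted modulo this relation.\<close>

definition ae_same :: "('a::finite \<Rightarrow> 'a set) \<Rightarrow>
   ((('a \<Rightarrow> real) \<times> ('a \<Rightarrow> 'a \<Rightarrow> real)) \<times> (('a \<Rightarrow> real) \<times> ('a \<Rightarrow> 'a \<Rightarrow> real))) set" where
  "ae_same T =
     {((\<mu>, Q), (\<mu>', Q')). (\<mu>, Q) \<in> stationary_pairs T \<and> (\<mu>', Q') \<in> stationary_pairs T \<and>
        \<mu> = \<mu>' \<and> (\<forall>i. \<mu> i > 0 \<longrightarrow> Q i = Q' i)}"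

lemma equiv_ae_same: "equiv (stationary_pairs T) (ae_same T)"
  by (rule equivI) (auto simp: ae_same_def refl_on_def sym_def trans_def)

text \<open>A path \<open>(x\<^sub>0, \<dots>, x\<^sub>n)\<close> is a list of length \<open>n + 1\<close>.\<close>

definition paths_of :: "('a \<Rightarrow> 'a set) \<Rightarrow> nat \<Rightarrow> 'a list set" where
  "paths_of T n = {xs. length xs = Suc n \<and> (\<forall>j<n. xs ! Suc j \<in> T (xs ! j))}"

definition empirical :: "nat \<Rightarrow> 'a list \<Rightarrow> 'a \<times> 'a \<Rightarrow> real" where
  "empirical n xs = (\<lambda>p. 1 / real n * (\<Sum>j<n. of_bool (p = (xs ! j, xs ! Suc j))))"

definition pressure_seq ::
  "('a::finite \<Rightarrow> 'a set) \<Rightarrow> (('a \<times> 'a \<Rightarrow> real) \<Rightarrow> real) \<Rightarrow> nat \<Rightarrow> real" where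
  "pressure_seq T \<E> n =
     1 / real n * ln (\<Sum>xs\<in>paths_of T n. exp (real n * \<E> (empirical n xs)))"

text \<open>\<^const>\<open>lim\<close> is meaningful only together with \<^term>\<open>convergent (pressure_seq T \<E>)\<close>.\<close>

definition nl_pressure :: "('a::finite \<Rightarrow> 'a set) \<Rightarrow> (('a \<times> 'a \<Rightarrow> real) \<Rightarrow> real) \<Rightarrow> real" where
  "nl_pressure T \<E> = lim (pressure_seq T \<E>)"

definition rel_entropy :: "('b::finite \<Rightarrow> real) \<Rightarrow> ('b \<Rightarrow> real) \<Rightarrow> ereal" where
  "rel_entropy p q =
     (if \<exists>b. p b > 0 \<and> q b = 0 then \<infinity>
      else ereal (\<Sum>b | p b \<noteq> 0. p b * ln (p b / q b)))"

definition product_vector :: "('a \<Rightarrow> real) \<Rightarrow> ('a \<Rightarrow> real) \<Rightarrow> 'a \<times> 'a \<Rightarrow> real" where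
  "product_vector p q = (\<lambda>(i, j). p i * q j)"

section \<open>The two-state system\<close>

typedef spin = "{-1, 1 :: int}"
  morphisms spin_val Spin
  by blast

instance spin :: finite
proof
  have "(UNIV :: spin set) = Spin ` {-1, 1}"
    using Spin_cases by blast
  then show "finite (UNIV :: spin set)" by (metis finite.emptyI finite.insertI finite_imageI)
qed

definition full_T :: "spin \<Rightarrow> spin set" where
  "full_T s = UNIV"

definition \<psi> :: "spin \<Rightarrow> spin \<Rightarrow> real" where
  "\<psi> s t = real_of_int (spin_val s * spin_val t)"

text \<open>The integral \<open>\<integral> s t d\<gamma>(s, t)\<close>.\<close>

definition correlation :: "(spin \<times> spin \<Rightarrow> real) \<Rightarrow> real" where
  "correlation \<gamma> = (\<Sum>(s, t)\<in>UNIV. \<psi> s t * \<gamma> (s, t))"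

definition spin_energy :: "real \<Rightarrow> (spin \<times> spin \<Rightarrow> real) \<Rightarrow> real" where
  "spin_energy \<beta> \<gamma> = \<beta> / 2 * (correlation \<gamma>)\<^sup>2"

text \<open>Meaningful only for \<open>\<beta> > 1\<close>.\<close>

definition magnetization :: "real \<Rightarrow> real" where
  "magnetization \<beta> = (THE m. 0 < m \<and> m = tanh (\<beta> * m))"

definition uniform_spin :: "spin \<Rightarrow> real" where
  "uniform_spin s = 1 / 2"

definition Q_spin :: "real \<Rightarrow> real \<Rightarrow> spin \<Rightarrow> spin \<Rightarrow> real" where
  "Q_spin \<beta> \<sigma> s t = (1 + \<sigma> * magnetization \<beta> * \<psi> s t) / 2"

definition \<gamma>_spin :: "real \<Rightarrow> real \<Rightarrow> spin \<times> spin \<Rightarrow> real" where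
  "\<gamma>_spin \<beta> \<sigma> = two_coord (uniform_spin, Q_spin \<beta> \<sigma>)"

end

theory Submission
  imports Defs "HOL-Real_Asymp.Real_Asymp"
begin

text \<open>
  Everything rests on one inequality. By Gibbs' inequality, applied to each row of the kernel
  against the row with entries \<open>exp (\<theta> s t) / (2 cosh \<theta>) = (1 + s t tanh \<theta>) / 2\<close>, every
  stationary pair with correlation \<open>r\<close> satisfies \<open>h + \<theta> r \<le> ln (2 cosh \<theta>)\<close>, with equality exactly
  when the rows of \<open>Q\<close> coincide \<open>\<mu>\<close>-almost everywhere with those rows (\<open>linear_variational\<close>).
  Taking \<open>\<theta> = \<beta> r\<close> turns the quadratic energy into a linear one and gives
  \<open>h + \<beta> r\<^sup>2 / 2 \<le> G r\<close> with the mean-field function \<open>G r = ln (2 cosh (\<beta> r)) - \<beta> r\<^sup>2 / 2\<close>.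

  Since \<open>G' r = \<beta> (tanh (\<beta> r) - r)\<close>, the shape of \<open>G\<close> is governed by the sign of
  \<open>tanh (\<beta> r) - r\<close>: the maximum of \<open>G\<close> is attained at \<open>m = 0\<close> when \<open>\<beta> \<le> 1\<close> and at \<open>\<plusminus>m\<close> when
  \<open>\<beta> > 1\<close>, where \<open>m\<close> is the positive fixed point of \<open>r \<mapsto> tanh (\<beta> r)\<close>, unique because
  \<open>tanh u / u\<close> decreases. For a maximizing pair both inequalities are equalities, so the rows of \<open>Q\<close>
  are those with correlation \<open>tanh (\<beta> r)\<close>. This number lies strictly between \<open>- 1\<close> and \<open>1\<close>; the
  entries of \<open>Q\<close> are therefore positive, which forces \<open>\<mu>\<close> to be uniform
  (\<open>stationary_sym_kernel_unique\<close>) and \<open>r = tanh (\<beta> r)\<close>. The two regimes \<open>\<beta> \<le> 1\<close> and \<open>\<beta> > 1\<close> are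
  treated together in \<open>equilibrium_pairs_eq\<close>.

  The pressure uses the same linearization on paths (\<open>partition_bounds\<close>). The convex function
  \<open>\<beta> c\<^sup>2 / 2\<close> lies above its tangent at \<open>a\<close>, and the partition function with the tangent at \<open>a\<close> in
  the exponent is \<open>2 exp (n (G a))\<close> by the transfer recursion. The choice \<open>a = m\<close> is a lower bound.
  For the upper bound, \<open>c\<close> takes at most \<open>2 n + 1\<close> values, and each summand equals the tangent
  summand at its own value of \<open>c\<close>. Hence the partition function is \<open>exp (n (G m))\<close> up to a factor
  of linear growth.
\<close>

section \<open>Gibbs' inequality\<close>

lemma mult_ln_ratio_le:
  fixes q w :: real
  assumes "0 \<le> q" "0 < w"
  shows "q * ln w - q * ln q \<le> w - q"
    and "q * ln w - q * ln q = w - q \<longleftrightarrow> q = w"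
proof -
  have *: "q * ln w - q * ln q < w - q" if "q \<noteq> w"
  proof (cases "q = 0")
    case False
    with assms have q: "0 < q" by simp
    then have "0 < w / q" "w / q \<noteq> 1" using assms that by auto
    then have "ln (w / q) \<le> w / q - 1" "ln (w / q) \<noteq> w / q - 1"
      using ln_le_minus_one ln_eq_minus_one by blast+
    then have "ln (w / q) < w / q - 1" by simp
    then have "q * ln (w / q) < q * (w / q - 1)"
      using q by simp
    then show ?thesis
      using q assms by (simp add: ln_div algebra_simps)
  qed (use assms in simp)
  then show "q * ln w - q * ln q \<le> w - q" by (cases "q = w") auto
  show "q * ln w - q * ln q = w - q \<longleftrightarrow> q = w"
    using * by (cases "q = w") (auto dest: less_imp_neq)
qed

lemma gibbs_inequality:
  fixes q w :: "'b::finite \<Rightarrow> real"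
  assumes q: "q \<in> prob_vectors" and w: "w \<in> prob_vectors" and pos: "\<And>b. 0 < w b"
  shows "(\<Sum>b\<in>UNIV. q b * ln (w b) - q b * ln (q b)) \<le> 0"
    and "(\<Sum>b\<in>UNIV. q b * ln (w b) - q b * ln (q b)) = 0 \<longleftrightarrow> q = w"
proof -
  let ?d = "\<lambda>b. (w b - q b) - (q b * ln (w b) - q b * ln (q b))"
  have q0: "0 \<le> q b" for b using q by (simp add: prob_vectors_def)
  have nonneg: "0 \<le> ?d b" for b
    using mult_ln_ratio_le(1)[OF q0 pos, of b b] by simp
  have "(\<Sum>b\<in>UNIV. w b - q b) = 0"
    using q w by (simp add: prob_vectors_def sum_subtractf)
  then have eq: "(\<Sum>b\<in>UNIV. q b * ln (w b) - q b * ln (q b)) = - (\<Sum>b\<in>UNIV. ?d b)"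
    by (simp add: sum_subtractf)
  then show "(\<Sum>b\<in>UNIV. q b * ln (w b) - q b * ln (q b)) \<le> 0"
    using sum_nonneg[of UNIV ?d] nonneg by simp
  have "(\<Sum>b\<in>UNIV. ?d b) = 0 \<longleftrightarrow> (\<forall>b. ?d b = 0)"
    using sum_nonneg_eq_0_iff[of UNIV ?d] nonneg by simp
  also have "\<dots> \<longleftrightarrow> (\<forall>b. q b = w b)"
    using mult_ln_ratio_le(2)[OF q0 pos] by (smt (verit, best))
  finally show "(\<Sum>b\<in>UNIV. q b * ln (w b) - q b * ln (q b)) = 0 \<longleftrightarrow> q = w"
    unfolding eq by auto
qed

section \<open>The two spins\<close>

lemma UNIV_spin: "(UNIV :: spin set) = {Spin 1, Spin (- 1)}"
  using Spin_cases by blast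

lemma spin_cases: "s = Spin 1 \<or> s = Spin (- 1)"
  using UNIV_spin by blast

lemma spin_neq [simp]: "Spin 1 \<noteq> Spin (- 1)" "Spin (- 1) \<noteq> Spin 1"
  by (simp_all add: Spin_inject)

lemma sum_spin: "(\<Sum>s\<in>UNIV. f s) = f (Spin 1) + f (Spin (- 1))"
  by (simp add: UNIV_spin)

lemma \<psi>_simps [simp]:
  "\<psi> (Spin 1) (Spin 1) = 1" "\<psi> (Spin (- 1)) (Spin (- 1)) = 1"
  "\<psi> (Spin 1) (Spin (- 1)) = - 1" "\<psi> (Spin (- 1)) (Spin 1) = - 1"
  by (simp_all add: \<psi>_def Spin_inverse)

lemma \<psi>_cases: "\<psi> s t = 1 \<or> \<psi> s t = - 1"
  using spin_cases[of s] spin_cases[of t] by auto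

lemma sum_\<psi>:
  shows "(\<Sum>t\<in>UNIV. f (\<psi> s t)) = f 1 + f (- 1)"
    and "(\<Sum>s\<in>UNIV. f (\<psi> s t)) = f 1 + f (- 1)"
  using spin_cases[of s] spin_cases[of t] by (auto simp: sum_spin add.commute)

lemma sum_pairs: "(\<Sum>p\<in>UNIV. f p) = (\<Sum>s\<in>UNIV. \<Sum>t\<in>UNIV. f (s, t))"
  by (simp add: sum.cartesian_product flip: UNIV_Times_UNIV)

lemma correlation_two_coord:
  "correlation (two_coord (\<mu>, Q)) = (\<Sum>s\<in>UNIV. \<mu> s * (\<Sum>t\<in>UNIV. Q s t * \<psi> s t))"
  by (simp add: correlation_def sum_pairs sum_distrib_left mult_ac)

section \<open>Spin-flip symmetric kernels and the linear variational principle\<close>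

text \<open>The kernel, invariant under flipping both spins, with correlation \<open>r\<close> between successive states
  under any initial distribution. Its entries are nonnegative only for \<open>\<bar>r\<bar> \<le> 1\<close>.\<close>

definition sym_kernel :: "real \<Rightarrow> spin \<Rightarrow> spin \<Rightarrow> real" where
  "sym_kernel r s t = (1 + r * \<psi> s t) / 2"

lemma sym_kernel_pos:
  assumes "\<bar>r\<bar> < 1"
  shows "0 < sym_kernel r s t"
  using \<psi>_cases[of s t] assms by (auto simp: sym_kernel_def)

lemma sum_sym_kernel: "(\<Sum>t\<in>UNIV. sym_kernel r s t) = 1"
  using sum_\<psi>(1)[of "\<lambda>x. (1 + r * x) / 2" s] by (simp add: sym_kernel_def field_simps)

lemma sym_kernel_stationary:
  assumes "\<bar>r\<bar> < 1"
  shows "(uniform_spin, sym_kernel r) \<in> stationary_pairs full_T"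
proof -
  have "(\<Sum>s\<in>UNIV. uniform_spin s * sym_kernel r s t) = uniform_spin t" for t
    using sum_\<psi>(2)[of "\<lambda>x. (1 + r * x) / 4" t]
    by (simp add: uniform_spin_def sym_kernel_def field_simps)
  moreover have "uniform_spin \<in> prob_vectors"
    by (simp add: prob_vectors_def uniform_spin_def sum_spin)
  ultimately show ?thesis
    using less_imp_le[OF sym_kernel_pos[OF assms]]
    by (simp add: stationary_pairs_def transition_kernel_def full_T_def sum_sym_kernel)
qed

lemma correlation_sym_kernel:
  "correlation (two_coord (uniform_spin, sym_kernel r)) = r"
  by (simp add: correlation_two_coord uniform_spin_def sym_kernel_def sum_spin field_simps)

text \<open>The rows of \<open>sym_kernel (tanh \<theta>)\<close> are the Gibbs distributions with weights
  \<open>exp (\<theta> * \<psi> s t)\<close>.\<close>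

lemma ln_sym_kernel_tanh:
  "ln (sym_kernel (tanh \<theta>) s t) = \<theta> * \<psi> s t - ln (2 * cosh \<theta>)"
proof -
  have "sym_kernel (tanh \<theta>) s t = exp (\<theta> * \<psi> s t) / (2 * cosh \<theta>)"
    using \<psi>_cases[of s t]
    by (auto simp: sym_kernel_def tanh_def divide_simps cosh_real_pos)
       (simp_all add: cosh_def sinh_def field_simps)
  then show ?thesis by (simp add: ln_div cosh_real_pos)
qed

text \<open>For the energy that is linear in the correlation, the defect of a stationary pair is the
  \<open>\<mu>\<close>-average of the relative entropies of the rows of \<open>Q\<close> with respect to the tilted kernel.\<close>

lemma linear_variational:
  assumes "(\<mu>, Q) \<in> stationary_pairs full_T"
  defines "r \<equiv> correlation (two_coord (\<mu>, Q))"
  shows "entropy_rate (\<mu>, Q) + \<theta> * r \<le> ln (2 * cosh \<theta>)"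
    and "entropy_rate (\<mu>, Q) + \<theta> * r = ln (2 * cosh \<theta>) \<longleftrightarrow>
           (\<forall>s. 0 < \<mu> s \<longrightarrow> Q s = sym_kernel (tanh \<theta>) s)"
proof -
  define w where "w = sym_kernel (tanh \<theta>)"
  define d where "d s = (\<Sum>t\<in>UNIV. Q s t * ln (w s t) - Q s t * ln (Q s t))" for s
  have \<mu>: "\<And>s. 0 \<le> \<mu> s" "(\<Sum>s\<in>UNIV. \<mu> s) = 1"
    and Q: "\<And>s. Q s \<in> prob_vectors" "\<And>s. (\<Sum>t\<in>UNIV. Q s t) = 1"
    using assms by (auto simp: stationary_pairs_def prob_vectors_def transition_kernel_def)
  have "\<bar>tanh \<theta>\<bar> < 1"
    using tanh_real_bounds[of \<theta>] by auto
  then have w: "0 < w s t" "w s \<in> prob_vectors" for s t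
    using sym_kernel_pos[of "tanh \<theta>"]
    by (auto simp: w_def prob_vectors_def sum_sym_kernel intro: less_imp_le)
  define A where "A s = (\<Sum>t\<in>UNIV. Q s t * \<psi> s t)" for s
  define B where "B s = (\<Sum>t\<in>UNIV. Q s t * ln (Q s t))" for s
  have "d s = \<theta> * A s - ln (2 * cosh \<theta>) - B s" for s
  proof -
    have "d s = (\<Sum>t\<in>UNIV. \<theta> * (Q s t * \<psi> s t) - Q s t * ln (2 * cosh \<theta>) - Q s t * ln (Q s t))"
      unfolding d_def w_def ln_sym_kernel_tanh by (simp add: right_diff_distrib mult_ac)
    then show ?thesis
      by (simp only: A_def B_def Q(2) mult_1 sum_subtractf
          sum_distrib_left[symmetric] sum_distrib_right[symmetric])
  qed
  then have "(\<Sum>s\<in>UNIV. \<mu> s * d s) =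
      (\<Sum>s\<in>UNIV. \<theta> * (\<mu> s * A s) - \<mu> s * ln (2 * cosh \<theta>) - \<mu> s * B s)"
    by (simp add: right_diff_distrib mult_ac)
  also have "\<dots> = \<theta> * (\<Sum>s\<in>UNIV. \<mu> s * A s) - ln (2 * cosh \<theta>) - (\<Sum>s\<in>UNIV. \<mu> s * B s)"
    by (simp only: \<mu>(2) mult_1 sum_subtractf
        sum_distrib_left[symmetric] sum_distrib_right[symmetric])
  also have "(\<Sum>s\<in>UNIV. \<mu> s * A s) = r"
    by (simp add: r_def correlation_two_coord A_def)
  also have "(\<Sum>s\<in>UNIV. \<mu> s * B s) = - entropy_rate (\<mu>, Q)"
    by (simp add: B_def sum_distrib_left mult.assoc)
  finally have gap: "entropy_rate (\<mu>, Q) + \<theta> * r - ln (2 * cosh \<theta>) = - (\<Sum>s\<in>UNIV. - (\<mu> s * d s))"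
    by (simp add: sum_negf)
  have d: "d s \<le> 0" "d s = 0 \<longleftrightarrow> Q s = w s" for s
    using gibbs_inequality[OF Q(1) w(2) w(1)] by (auto simp: d_def)
  then have nonneg: "0 \<le> - (\<mu> s * d s)" for s
    using \<mu>(1)[of s] by (simp add: mult_nonneg_nonpos)
  then show "entropy_rate (\<mu>, Q) + \<theta> * r \<le> ln (2 * cosh \<theta>)"
    using gap sum_nonneg[of UNIV "\<lambda>s. - (\<mu> s * d s)"] by simp
  have "entropy_rate (\<mu>, Q) + \<theta> * r = ln (2 * cosh \<theta>) \<longleftrightarrow> (\<Sum>s\<in>UNIV. - (\<mu> s * d s)) = 0"
    using gap by auto
  also have "\<dots> \<longleftrightarrow> (\<forall>s. - (\<mu> s * d s) = 0)"
    using nonneg by (subst sum_nonneg_eq_0_iff) auto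
  also have "\<dots> \<longleftrightarrow> (\<forall>s. 0 < \<mu> s \<longrightarrow> Q s = w s)"
    using d(2) \<mu>(1) by (simp add: less_le) (metis)
  finally show "entropy_rate (\<mu>, Q) + \<theta> * r = ln (2 * cosh \<theta>) \<longleftrightarrow>
           (\<forall>s. 0 < \<mu> s \<longrightarrow> Q s = sym_kernel (tanh \<theta>) s)"
    by (simp add: w_def)
qed

text \<open>If the rows of \<open>Q\<close> are those of \<open>sym_kernel r\<close> on the support of \<open>\<mu>\<close>, then they are so
  everywhere: the entries are positive, so that stationarity forces full support.\<close>

lemma stationary_sym_kernel_unique:
  assumes st: "(\<mu>, Q) \<in> stationary_pairs full_T" and r: "\<bar>r\<bar> < 1"
    and Q: "\<And>s. 0 < \<mu> s \<Longrightarrow> Q s = sym_kernel r s"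
  shows "\<mu> = uniform_spin \<and> Q = sym_kernel r"
proof -
  let ?u = "Spin 1" and ?d = "Spin (- 1)"
  have "\<mu> \<in> prob_vectors"
    using st unfolding stationary_pairs_def by blast
  then have \<mu>: "\<And>s. 0 \<le> \<mu> s" "\<mu> ?u + \<mu> ?d = 1"
    by (auto simp: prob_vectors_def sum_spin)
  have "\<forall>t. (\<Sum>s\<in>UNIV. \<mu> s * Q s t) = \<mu> t"
    using st unfolding stationary_pairs_def by blast
  then have bal: "\<mu> ?u * Q ?u ?u + \<mu> ?d * Q ?d ?u = \<mu> ?u"
      "\<mu> ?u * Q ?u ?d + \<mu> ?d * Q ?d ?d = \<mu> ?d"
    unfolding sum_spin by blast+
  have "\<mu> ?u \<noteq> 0"
  proof
    assume z: "\<mu> ?u = 0"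
    then have one: "\<mu> ?d = 1" using \<mu>(2) by linarith
    have "Q ?d ?u = 0" using bal(1) unfolding z one by linarith
    then show False using Q[of ?d] one sym_kernel_pos[OF r, of ?d ?u] by simp
  qed
  moreover have "\<mu> ?d \<noteq> 0"
  proof
    assume z: "\<mu> ?d = 0"
    then have one: "\<mu> ?u = 1" using \<mu>(2) by linarith
    have "Q ?u ?d = 0" using bal(2) unfolding z one by linarith
    then show False using Q[of ?u] one sym_kernel_pos[OF r, of ?u ?d] by simp
  qed
  ultimately have pos: "0 < \<mu> s" for s
    using \<mu>(1)[of s] spin_cases[of s] by (auto simp: less_le)
  have eq: "Q = sym_kernel r" using Q[OF pos] by blast
  have "\<mu> ?u * sym_kernel r ?u ?u + \<mu> ?d * sym_kernel r ?d ?u - \<mu> ?u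
      = - ((1 - r) * (\<mu> ?u - \<mu> ?d)) / 2"
    by (simp add: sym_kernel_def field_simps)
  then have "(1 - r) * (\<mu> ?u - \<mu> ?d) = 0"
    using bal(1) unfolding eq by linarith
  then have "\<mu> ?u = \<mu> ?d" using r by auto
  then have "\<mu> s = uniform_spin s" for s
    using \<mu>(2) spin_cases[of s] by (auto simp: uniform_spin_def)
  then show ?thesis using eq by auto
qed

section \<open>The mean-field function and the fixed points of \<open>r \<mapsto> tanh (\<beta> r)\<close>\<close>

text \<open>An upper bound for entropy plus energy over the stationary pairs with correlation \<open>r\<close>, attained
  when \<open>r\<close> is a fixed point of \<open>r \<mapsto> tanh (\<beta> r)\<close>.\<close>

definition mean_field :: "real \<Rightarrow> real \<Rightarrow> real" where
  "mean_field \<beta> r = ln (2 * cosh (\<beta> * r)) - \<beta> / 2 * r\<^sup>2"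

lemma mean_field_deriv:
  "(mean_field \<beta> has_real_derivative \<beta> * (tanh (\<beta> * r) - r)) (at r)"
  unfolding mean_field_def [abs_def]
  by (rule derivative_eq_intros refl | simp add: cosh_real_pos)+
     (simp add: tanh_def field_simps)

lemma mean_field_abs: "mean_field \<beta> \<bar>r\<bar> = mean_field \<beta> r"
  by (simp add: mean_field_def abs_if)

lemma fixed_point_abs:
  fixes \<beta> r :: real
  assumes "r = tanh (\<beta> * r)"
  shows "\<bar>r\<bar> = tanh (\<beta> * \<bar>r\<bar>)"
  using assms by (cases "0 \<le> r") auto

text \<open>The point \<open>m\<close> is where \<open>tanh (\<beta> r) - r\<close> passes from positive to negative on the positive
  half-line. The value \<open>m = 0\<close> is admitted and means that this function is negative on the whole
  positive half-line; it allows both temperature regimes to be treated at once.\<close>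

definition sign_change :: "real \<Rightarrow> real \<Rightarrow> bool" where
  "sign_change \<beta> m \<longleftrightarrow> 0 \<le> m \<and> m = tanh (\<beta> * m) \<and>
     (\<forall>r. 0 < r \<and> r < m \<longrightarrow> r < tanh (\<beta> * r)) \<and> (\<forall>r>m. tanh (\<beta> * r) < r)"

lemma mean_field_le:
  assumes "0 \<le> \<beta>" "sign_change \<beta> m"
  shows "mean_field \<beta> r \<le> mean_field \<beta> m"
proof -
  have "mean_field \<beta> r \<le> mean_field \<beta> m" if "0 \<le> r" for r
  proof (cases "r \<le> m")
    case True
    then show ?thesis
    proof (rule DERIV_nonneg_imp_nondecreasing)
      fix x assume x: "r \<le> x" "x \<le> m"
      have "x \<le> tanh (\<beta> * x)"
        using assms(2) x that unfolding sign_change_def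
        by (cases "x = 0"; cases "x = m") (auto intro!: less_imp_le)
      then show "\<exists>y. DERIV (mean_field \<beta>) x :> y \<and> 0 \<le> y"
        using mean_field_deriv assms(1) by (auto intro!: exI)
    qed
  next
    case False
    then have "m \<le> r" by simp
    then show ?thesis
    proof (rule DERIV_nonpos_imp_nonincreasing)
      fix x assume x: "m \<le> x" "x \<le> r"
      have "tanh (\<beta> * x) \<le> x"
        using assms(2) x unfolding sign_change_def by (cases "x = m") (auto intro!: less_imp_le)
      then show "\<exists>y. DERIV (mean_field \<beta>) x :> y \<and> y \<le> 0"
        using mean_field_deriv assms(1) by (auto intro!: exI mult_nonneg_nonpos)
    qed
  qed
  from this[of "\<bar>r\<bar>"] show ?thesis by (simp add: mean_field_abs)
qed

lemma mean_field_0_less: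
  assumes "0 < \<beta>" "sign_change \<beta> m" "0 < m"
  shows "mean_field \<beta> 0 < mean_field \<beta> m"
proof (rule DERIV_pos_imp_increasing_open[OF assms(3)])
  fix x assume "0 < x" "x < m"
  then have "0 < \<beta> * (tanh (\<beta> * x) - x)"
    using assms by (simp add: sign_change_def)
  then show "\<exists>y. DERIV (mean_field \<beta>) x :> y \<and> 0 < y"
    using mean_field_deriv by blast
next
  show "continuous_on {0..m} (mean_field \<beta>)"
    using mean_field_deriv by (meson DERIV_isCont continuous_at_imp_continuous_on)
qed

lemma mean_field_maximal_fixed_point:
  assumes "0 \<le> \<beta>" "sign_change \<beta> m" "r = tanh (\<beta> * r)" "mean_field \<beta> r = mean_field \<beta> m"
  shows "r = m \<or> r = - m"
proof -
  have "\<bar>r\<bar> = m"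
  proof (rule ccontr)
    assume "\<bar>r\<bar> \<noteq> m"
    \<comment> \<open>Away from \<open>m\<close> the only possible fixed point on the nonnegative half-line is \<open>0\<close>.\<close>
    then have "r = 0" "0 < m"
      using assms(2) fixed_point_abs[OF assms(3)] unfolding sign_change_def
      by (smt (verit))+
    moreover have "\<beta> \<noteq> 0"
      using assms(2) \<open>0 < m\<close> by (auto simp: sign_change_def)
    ultimately show False
      using mean_field_0_less[of \<beta> m] assms by simp
  qed
  then show ?thesis by linarith
qed

lemma tanh_less_self:
  fixes x :: real
  assumes "0 < x"
  shows "tanh x < x"
proof -
  have "(\<lambda>x. tanh x - x) x < (\<lambda>x. tanh x - x) (0 :: real)"
  proof (rule DERIV_neg_imp_decreasing_open[OF assms])
    fix y :: real assume y: "0 < y" "y < x"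
    have "((\<lambda>x. tanh x - x) has_real_derivative (1 - tanh y ^ 2 - 1)) (at y)"
      by (auto intro!: derivative_eq_intros)
    moreover have "1 - tanh y ^ 2 - 1 < 0" using y by simp
    ultimately show "\<exists>z. ((\<lambda>x. tanh x - x) has_real_derivative z) (at y) \<and> z < 0" by blast
  qed (auto intro!: continuous_intros)
  then show ?thesis by simp
qed

lemma sign_change_0:
  assumes "0 \<le> \<beta>" "\<beta> \<le> 1"
  shows "sign_change \<beta> 0"
proof -
  have "tanh (\<beta> * r) < r" if "0 < r" for r
  proof (cases "\<beta> = 0")
    case False
    then have "tanh (\<beta> * r) < \<beta> * r"
      using assms that by (intro tanh_less_self) simp
    also have "\<dots> \<le> r" using assms that by (simp add: mult_le_cancel_right1)
    finally show ?thesis .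
  qed (use that in simp)
  then show ?thesis by (simp add: sign_change_def)
qed

text \<open>This monotonicity makes the positive fixed point unique: at a fixed point \<open>m > 0\<close> the quotient
  \<open>tanh u / u\<close> has the value \<open>1 / \<beta>\<close> at \<open>u = \<beta> m\<close>.\<close>

lemma tanh_div_self_decreasing:
  fixes x y :: real
  assumes "0 < x" "x < y"
  shows "tanh y / y < tanh x / x"
proof (rule DERIV_neg_imp_decreasing_open[OF assms(2)])
  fix z assume "x < z" "z < y"
  then have z: "0 < z" using assms by simp
  have "((\<lambda>x. tanh x / x) has_real_derivative ((1 - tanh z ^ 2) * z - tanh z) / (z * z)) (at z)"
    using z by (auto intro!: derivative_eq_intros)
  moreover have "(1 - tanh z ^ 2) * z < tanh z"
  proof -
    \<comment> \<open>The numerator of the derivative, up to sign; it vanishes at \<open>0\<close> and increases.\<close>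
    let ?f = "\<lambda>x. tanh x - (1 - tanh x ^ 2) * x :: real"
    have "?f 0 < ?f z"
    proof (rule DERIV_pos_imp_increasing_open[OF z])
      fix u assume u: "0 < u" "u < z"
      have "(?f has_real_derivative 2 * tanh u * (1 - tanh u ^ 2) * u) (at u)"
        by (auto intro!: derivative_eq_intros simp: algebra_simps)
      moreover have "tanh u ^ 2 < 1"
        using tanh_real_bounds[of u] by (simp add: abs_square_less_1 abs_less_iff)
      ultimately show "\<exists>d. (?f has_real_derivative d) (at u) \<and> 0 < d"
        using u by (intro exI conjI) (assumption, simp)
    qed (auto intro!: continuous_intros)
    then show ?thesis by simp
  qed
  ultimately show "\<exists>d. ((\<lambda>x. tanh x / x) has_real_derivative d) (at z) \<and> d < 0"
    using z by (intro exI conjI) (auto simp: divide_less_0_iff)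
next
  show "continuous_on {x..y} (\<lambda>x. tanh x / x)"
    using assms by (auto intro!: continuous_intros)
qed

lemma positive_fixed_point_exists:
  fixes \<beta> :: real
  assumes "1 < \<beta>"
  shows "\<exists>m. 0 < m \<and> m = tanh (\<beta> * m)"
proof -
  let ?g = "\<lambda>x. tanh (\<beta> * x) - x"
  have "(?g has_real_derivative (\<beta> - 1)) (at 0)"
    by (auto intro!: derivative_eq_intros)
  from DERIV_pos_inc_right[OF this] assms obtain d
    where d: "0 < d" "\<And>h. 0 < h \<Longrightarrow> h < d \<Longrightarrow> 0 < ?g h" by auto
  define a where "a = min (d / 2) 1"
  have a: "0 < a" "a \<le> 1" "0 < ?g a" using d by (auto simp: a_def)
  have "?g 1 < 0" using tanh_real_bounds[of \<beta>] by simp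
  then obtain m where "a \<le> m" "m \<le> 1" "?g m = 0"
    using IVT2'[of ?g 1 0 a] a by (force intro!: continuous_intros)
  then show ?thesis using a by (intro exI[of _ m]) auto
qed

lemma fixed_point_sign_change:
  assumes "1 < \<beta>" "0 < m" "m = tanh (\<beta> * m)"
  shows "sign_change \<beta> m"
proof -
  have eq: "tanh (\<beta> * m) / (\<beta> * m) = 1 / \<beta>" using assms by simp
  have "r < tanh (\<beta> * r)" if "0 < r" "r < m" for r
    using tanh_div_self_decreasing[of "\<beta> * r" "\<beta> * m"] assms(1,2) that unfolding eq
    by (simp add: divide_simps split: if_splits)
  moreover have "tanh (\<beta> * r) < r" if "m < r" for r
    using tanh_div_self_decreasing[of "\<beta> * m" "\<beta> * r"] assms(1,2) that unfolding eq
    by (simp add: divide_simps split: if_splits)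
  ultimately show ?thesis using assms by (auto simp: sign_change_def)
qed

lemma positive_fixed_point_unique:
  fixes \<beta> :: real
  assumes "1 < \<beta>"
  shows "\<exists>!m. 0 < m \<and> m = tanh (\<beta> * m)"
proof (rule ex_ex1I[OF positive_fixed_point_exists[OF assms]])
  fix m m' assume m: "0 < m \<and> m = tanh (\<beta> * m)" and m': "0 < m' \<and> m' = tanh (\<beta> * m')"
  then have "sign_change \<beta> m" using fixed_point_sign_change[OF assms] by blast
  with m m' show "m = m'" unfolding sign_change_def by (metis less_irrefl linorder_neqE)
qed

section \<open>Equilibrium pairs\<close>

text \<open>The linear bound with tilt \<open>\<beta> r\<close> chosen from the correlation \<open>r\<close> of the pair itself.\<close>

lemma pair_value_le:
  assumes "(\<mu>, Q) \<in> stationary_pairs full_T"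
  defines "r \<equiv> correlation (two_coord (\<mu>, Q))"
  shows "entropy_rate (\<mu>, Q) + spin_energy \<beta> (two_coord (\<mu>, Q)) \<le> mean_field \<beta> r"
    and "entropy_rate (\<mu>, Q) + spin_energy \<beta> (two_coord (\<mu>, Q)) = mean_field \<beta> r \<longleftrightarrow>
           (\<forall>s. 0 < \<mu> s \<longrightarrow> Q s = sym_kernel (tanh (\<beta> * r)) s)"
  using linear_variational[OF assms(1), of "\<beta> * r"]
  by (auto simp: mean_field_def spin_energy_def r_def power2_eq_square)

lemma equilibrium_pairs_eq:
  assumes "0 \<le> \<beta>" and m: "sign_change \<beta> m"
  shows "nl_equilibrium_pairs full_T (spin_energy \<beta>) =
           (\<lambda>\<sigma>. (uniform_spin, sym_kernel (\<sigma> * m))) ` {- 1, 1}"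
proof -
  let ?J = "\<lambda>p. entropy_rate p + spin_energy \<beta> (two_coord p)"
  have tanh: "tanh (\<beta> * (\<sigma> * m)) = \<sigma> * m" if "\<sigma> \<in> {- 1, 1}" for \<sigma>
    using m that by (auto simp: sign_change_def)
  have m1: "\<bar>\<sigma> * m\<bar> < 1" if "\<sigma> \<in> {- 1, 1}" for \<sigma>
    using tanh_real_bounds[of "\<beta> * (\<sigma> * m)"] tanh[OF that] by auto
  have st: "(uniform_spin, sym_kernel (\<sigma> * m)) \<in> stationary_pairs full_T" if "\<sigma> \<in> {- 1, 1}" for \<sigma>
    using sym_kernel_stationary m1 that by blast
  have val: "?J (uniform_spin, sym_kernel (\<sigma> * m)) = mean_field \<beta> m" if "\<sigma> \<in> {- 1, 1}" for \<sigma>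
  proof -
    have "?J (uniform_spin, sym_kernel (\<sigma> * m)) = mean_field \<beta> (\<sigma> * m)"
      using pair_value_le(2)[OF st[OF that], of \<beta>] tanh[OF that]
      by (simp add: correlation_sym_kernel)
    then show ?thesis
      using mean_field_abs[of \<beta> "\<sigma> * m"] mean_field_abs[of \<beta> m] that by (auto simp: abs_mult)
  qed
  have le: "?J p \<le> mean_field \<beta> m" if "p \<in> stationary_pairs full_T" for p
    using pair_value_le(1)[of "fst p" "snd p" \<beta>] mean_field_le[OF assms] that
    by (metis order_trans prod.collapse)
  have max_unique: "p \<in> (\<lambda>\<sigma>. (uniform_spin, sym_kernel (\<sigma> * m))) ` {- 1, 1}"
    if p: "p \<in> stationary_pairs full_T" and max: "?J p = mean_field \<beta> m" for p
  proof -
    obtain \<mu> Q where pq: "p = (\<mu>, Q)" by (cases p)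
    define r where "r = correlation (two_coord p)"
    note val = pair_value_le[OF p[unfolded pq], of \<beta>, folded pq, folded r_def]
    have mf: "mean_field \<beta> r = mean_field \<beta> m"
      using val(1) max mean_field_le[OF assms, of r] by linarith
    with val(2) max have "\<And>s. 0 < \<mu> s \<Longrightarrow> Q s = sym_kernel (tanh (\<beta> * r)) s" by simp
    then have pQ: "\<mu> = uniform_spin" "Q = sym_kernel (tanh (\<beta> * r))"
      using stationary_sym_kernel_unique[OF p[unfolded pq], of "tanh (\<beta> * r)"]
        tanh_real_bounds[of "\<beta> * r"] by auto
    then have "r = tanh (\<beta> * r)"
      using r_def pq correlation_sym_kernel[of "tanh (\<beta> * r)"] by metis
    with mean_field_maximal_fixed_point[OF assms this mf] pQ pq show ?thesis by auto
  qed
  show ?thesis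
    unfolding nl_equilibrium_pairs_def
  proof (intro set_eqI iffI)
    fix p assume "p \<in> {p \<in> stationary_pairs full_T. \<forall>q\<in>stationary_pairs full_T. ?J q \<le> ?J p}"
    then show "p \<in> (\<lambda>\<sigma>. (uniform_spin, sym_kernel (\<sigma> * m))) ` {- 1, 1}"
      using st[of 1] val[of 1] le[of p] by (intro max_unique) force+
  next
    fix p assume "p \<in> (\<lambda>\<sigma>. (uniform_spin, sym_kernel (\<sigma> * m))) ` {- 1, 1}"
    then obtain \<sigma> where \<sigma>: "\<sigma> \<in> {- 1, 1}" "p = (uniform_spin, sym_kernel (\<sigma> * m))" by blast
    show "p \<in> {p \<in> stationary_pairs full_T. \<forall>q\<in>stationary_pairs full_T. ?J q \<le> ?J p}"
      using st[OF \<sigma>(1)] le unfolding \<sigma>(2) mem_Collect_eq val[OF \<sigma>(1)] by blast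
  qed
qed

section \<open>Nonlinear pressure\<close>

lemma paths_full: "paths_of full_T n = {xs. length xs = Suc n}"
  by (simp add: paths_of_def full_T_def)

lemma paths_full_Suc:
  "paths_of full_T (Suc n) = (\<lambda>(s, xs). s # xs) ` (UNIV \<times> paths_of full_T n)"
  by (auto simp: paths_full length_Suc_conv image_iff)

text \<open>The sum of the products of successive spins along a path, \<open>n\<close> times the correlation of its
  empirical pair distribution.\<close>

definition bond_sum :: "nat \<Rightarrow> spin list \<Rightarrow> real" where
  "bond_sum n xs = (\<Sum>j<n. \<psi> (xs ! j) (xs ! Suc j))"

text \<open>Prepending a spin multiplies the sum by \<open>2 cosh \<theta>\<close>, whatever the next spin is.\<close>

lemma sum_exp_bond_sum:
  "(\<Sum>xs\<in>paths_of full_T n. exp (\<theta> * bond_sum n xs)) = 2 * (2 * cosh \<theta>) ^ n"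
proof (induction n)
  case 0
  have "paths_of full_T 0 = (\<lambda>s. [s]) ` UNIV"
    by (auto simp: paths_full length_Suc_conv)
  then show ?case
    by (simp add: bond_sum_def card_image inj_on_def UNIV_spin)
next
  case (Suc n)
  have step: "(\<Sum>s\<in>UNIV. exp (\<theta> * bond_sum (Suc n) (s # xs))) =
      2 * cosh \<theta> * exp (\<theta> * bond_sum n xs)" for xs
  proof -
    have "(\<Sum>s\<in>UNIV. exp (\<theta> * \<psi> s (xs ! 0))) = 2 * cosh \<theta>"
      using sum_\<psi>(2)[of "\<lambda>x. exp (\<theta> * x)"] by (simp add: cosh_def)
    then show ?thesis
      by (simp add: bond_sum_def sum.lessThan_Suc_shift distrib_left exp_add
          del: sum.lessThan_Suc flip: sum_distrib_right)
  qed
  have "(\<Sum>xs\<in>paths_of full_T (Suc n). exp (\<theta> * bond_sum (Suc n) xs)) =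
      (\<Sum>s\<in>UNIV. \<Sum>xs\<in>paths_of full_T n. exp (\<theta> * bond_sum (Suc n) (s # xs)))"
    unfolding paths_full_Suc
    by (subst sum.reindex) (auto simp: inj_on_def sum.cartesian_product case_prod_unfold)
  also have "\<dots> = 2 * cosh \<theta> * (\<Sum>xs\<in>paths_of full_T n. exp (\<theta> * bond_sum n xs))"
    by (subst sum.swap) (simp add: step sum_distrib_left)
  finally show ?case using Suc.IH by simp
qed

lemma correlation_empirical: "correlation (empirical n xs) = bond_sum n xs / n"
proof -
  have delta: "(\<Sum>p\<in>UNIV. (case p of (s, t) \<Rightarrow> \<psi> s t) * of_bool (p = (a, b))) = \<psi> a b" for a b
    by (simp add: of_bool_def if_distrib cong: if_cong)
  have "correlation (empirical n xs) = (\<Sum>p\<in>UNIV. \<Sum>j<n.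
      1 / n * ((case p of (s, t) \<Rightarrow> \<psi> s t) * of_bool (p = (xs ! j, xs ! Suc j))))"
    unfolding correlation_def empirical_def sum_distrib_left
    by (intro sum.cong refl) (simp only: case_prod_unfold sum_distrib_left prod.collapse mult_ac)
  also have "\<dots> = (\<Sum>j<n. 1 / n * \<psi> (xs ! j) (xs ! Suc j))"
    by (subst sum.swap) (simp only: delta flip: sum_distrib_left)
  finally show ?thesis by (simp add: bond_sum_def sum_divide_distrib)
qed

lemma bond_sum_values: "bond_sum n xs \<in> real_of_int ` {- int n..int n}"
proof -
  define k where "k = (\<Sum>j<n. spin_val (xs ! j) * spin_val (xs ! Suc j))"
  have "bond_sum n xs = real_of_int k"
    by (simp add: bond_sum_def k_def \<psi>_def)
  moreover have "\<bar>bond_sum n xs\<bar> \<le> real (card {..<n}) * 1"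
    unfolding bond_sum_def
  proof (rule order_trans[OF sum_abs], rule sum_bounded_above)
    show "\<bar>\<psi> (xs ! j) (xs ! Suc j)\<bar> \<le> 1" for j
      using \<psi>_cases[of "xs ! j" "xs ! Suc j"] by auto
  qed
  ultimately have "bond_sum n xs = real_of_int k" "k \<in> {- int n..int n}" by auto
  then show ?thesis by blast
qed

text \<open>The partition function in which \<open>\<beta> c\<^sup>2 / 2\<close> is replaced by its tangent at \<open>a\<close>, evaluated at the
  correlation \<open>c\<close> of the path.\<close>

lemma sum_exp_tangent:
  assumes "0 < n"
  shows "(\<Sum>xs\<in>paths_of full_T n. exp (n * (\<beta> * a * (bond_sum n xs / n) - \<beta> / 2 * a\<^sup>2))) =
    2 * exp (n * mean_field \<beta> a)"
proof -
  have "(\<Sum>xs\<in>paths_of full_T n. exp (n * (\<beta> * a * (bond_sum n xs / n) - \<beta> / 2 * a\<^sup>2))) =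
     (\<Sum>xs\<in>paths_of full_T n. exp (\<beta> * a * bond_sum n xs)) * exp (- (n * (\<beta> / 2 * a\<^sup>2)))"
    using assms by (simp add: sum_distrib_right right_diff_distrib flip: exp_add)
  also have "\<dots> = 2 * (exp (ln (2 * cosh (\<beta> * a)))) ^ n * exp (- (n * (\<beta> / 2 * a\<^sup>2)))"
    by (simp add: sum_exp_bond_sum cosh_real_pos)
  also have "\<dots> = 2 * exp (n * ln (2 * cosh (\<beta> * a)) + - (n * (\<beta> / 2 * a\<^sup>2)))"
    by (simp only: exp_of_nat_mult exp_add mult.assoc)
  also have "\<dots> = 2 * exp (n * mean_field \<beta> a)"
    by (simp add: mean_field_def right_diff_distrib)
  finally show ?thesis .
qed

lemma partition_bounds:
  assumes \<beta>: "0 \<le> \<beta>" and m: "sign_change \<beta> m" and n: "0 < n"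
  defines "Z \<equiv> \<Sum>xs\<in>paths_of full_T n. exp (n * spin_energy \<beta> (empirical n xs))"
  shows "2 * exp (n * mean_field \<beta> m) \<le> Z" "Z \<le> (2 * real n + 1) * (2 * exp (n * mean_field \<beta> m))"
proof -
  let ?c = "\<lambda>xs. bond_sum n xs / n"
  let ?t = "\<lambda>a xs. exp (n * (\<beta> * a * ?c xs - \<beta> / 2 * a\<^sup>2))"
  have Z: "Z = (\<Sum>xs\<in>paths_of full_T n. exp (n * (\<beta> / 2 * (?c xs)\<^sup>2)))"
    by (simp add: Z_def spin_energy_def correlation_empirical)
  have tangent: "\<beta> * a * c - \<beta> / 2 * a\<^sup>2 \<le> \<beta> / 2 * c\<^sup>2" for a c
  proof -
    have "0 \<le> \<beta> / 2 * (c - a)\<^sup>2" using \<beta> by simp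
    then show ?thesis by (simp add: power2_eq_square algebra_simps)
  qed
  have "2 * exp (n * mean_field \<beta> m) = (\<Sum>xs\<in>paths_of full_T n. ?t m xs)"
    using sum_exp_tangent[OF n] by simp
  also have "\<dots> \<le> Z"
    unfolding Z by (intro sum_mono) (simp only: exp_le_cancel_iff, intro mult_left_mono tangent, simp)
  finally show "2 * exp (n * mean_field \<beta> m) \<le> Z" .
  let ?K = "{- int n..int n}"
  \<comment> \<open>The tangent taken at the value \<open>k / n\<close> of the correlation itself is exact; the unknown value
      is removed by summing over all possible ones.\<close>
  have "exp (n * (\<beta> / 2 * (?c xs)\<^sup>2)) \<le> (\<Sum>k\<in>?K. ?t (k / n) xs)" for xs
  proof -
    obtain k where k: "k \<in> ?K" "bond_sum n xs = real_of_int k"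
      using bond_sum_values by blast
    have "exp (n * (\<beta> / 2 * (?c xs)\<^sup>2)) = ?t (k / n) xs"
      unfolding k(2) by (simp add: power2_eq_square)
    also have "\<dots> \<le> (\<Sum>k\<in>?K. ?t (k / n) xs)"
      using k by (intro member_le_sum) auto
    finally show ?thesis .
  qed
  then have "Z \<le> (\<Sum>xs\<in>paths_of full_T n. \<Sum>k\<in>?K. ?t (k / n) xs)"
    unfolding Z by (intro sum_mono)
  also have "\<dots> = (\<Sum>k\<in>?K. 2 * exp (n * mean_field \<beta> (k / n)))"
    by (subst sum.swap) (simp only: sum_exp_tangent[OF n])
  also have "\<dots> \<le> (\<Sum>k\<in>?K. 2 * exp (n * mean_field \<beta> m))"
    by (intro sum_mono) (simp add: mult_left_mono mean_field_le[OF \<beta> m])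
  also have "\<dots> = (2 * real n + 1) * (2 * exp (n * mean_field \<beta> m))"
    by (simp add: nat_add_distrib flip: of_nat_Suc)
  finally show "Z \<le> (2 * real n + 1) * (2 * exp (n * mean_field \<beta> m))" .
qed

lemma pressure_seq_tendsto:
  assumes "0 \<le> \<beta>" "sign_change \<beta> m"
  shows "pressure_seq full_T (spin_energy \<beta>) \<longlonglongrightarrow> mean_field \<beta> m"
proof (rule tendsto_sandwich)
  let ?P = "mean_field \<beta> m"
  have b: "?P + ln 2 / n \<le> pressure_seq full_T (spin_energy \<beta>) n"
    "pressure_seq full_T (spin_energy \<beta>) n \<le> ?P + ln (2 * (2 * real n + 1)) / n" if n: "0 < n" for n
  proof -
    define Z where "Z = (\<Sum>xs\<in>paths_of full_T n. exp (n * spin_energy \<beta> (empirical n xs)))"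
    note Z = partition_bounds[OF assms n, folded Z_def]
    have "0 < Z" using Z(1) by (smt (verit) exp_gt_zero)
    then have "ln (2 * exp (n * ?P)) \<le> ln Z" "ln Z \<le> ln ((2 * real n + 1) * (2 * exp (n * ?P)))"
      using Z by (simp_all only: ln_le_cancel_iff) auto
    moreover have "ln (2 * (2 * real n + 1)) = ln 2 + ln (2 * real n + 1)"
      by (subst ln_mult) auto
    ultimately have "ln 2 + n * ?P \<le> ln Z" "ln Z \<le> ln (2 * (2 * real n + 1)) + n * ?P"
      by (simp_all add: ln_mult)
    then show "?P + ln 2 / n \<le> pressure_seq full_T (spin_energy \<beta>) n"
      "pressure_seq full_T (spin_energy \<beta>) n \<le> ?P + ln (2 * (2 * real n + 1)) / n"
      using n divide_right_mono[of _ "ln Z" n] divide_right_mono[of "ln Z" _ n]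
      unfolding pressure_seq_def Z_def[symmetric] by (fastforce simp: add_divide_distrib)+
  qed
  show "\<forall>\<^sub>F n in sequentially. ?P + ln 2 / n \<le> pressure_seq full_T (spin_energy \<beta>) n"
    "\<forall>\<^sub>F n in sequentially.
      pressure_seq full_T (spin_energy \<beta>) n \<le> ?P + ln (2 * (2 * real n + 1)) / n"
    using b by (auto intro!: eventually_mono[OF eventually_gt_at_top[of 0]])
  show "(\<lambda>n. ?P + ln 2 / real n) \<longlonglongrightarrow> ?P" by real_asymp
  show "(\<lambda>n. ?P + ln (2 * (2 * real n + 1)) / real n) \<longlonglongrightarrow> ?P" by real_asymp
qed

section \<open>Dependence of successive spins\<close>

lemma two_coord_sym_kernel:
  "two_coord (uniform_spin, sym_kernel r) (s, t) = (1 + r * \<psi> s t) / 4"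
  by (simp add: uniform_spin_def sym_kernel_def)

lemma two_coord_sym_kernel_marginals:
  "(\<Sum>t\<in>UNIV. two_coord (uniform_spin, sym_kernel r) (s, t)) = 1 / 2"
  "(\<Sum>s\<in>UNIV. two_coord (uniform_spin, sym_kernel r) (s, t)) = 1 / 2"
  unfolding two_coord_sym_kernel
  using sum_\<psi>[of "\<lambda>x. (1 + r * x) / 4"] by (simp_all add: field_simps)

lemma two_coord_sym_kernel_not_product:
  assumes "r \<noteq> 0" "p \<in> prob_vectors" "q \<in> prob_vectors"
  shows "two_coord (uniform_spin, sym_kernel r) \<noteq> product_vector p q"
proof
  assume eq: "two_coord (uniform_spin, sym_kernel r) = product_vector p q"
  have half: "p s = 1 / 2" "q s = 1 / 2" for s
    using two_coord_sym_kernel_marginals[of r] assms(2,3) unfolding eq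
    by (simp_all add: product_vector_def prob_vectors_def flip: sum_distrib_left sum_distrib_right)
  then have "two_coord (uniform_spin, sym_kernel r) (Spin 1, Spin 1) = 1 / 2 * (1 / 2)"
    using half by (simp only: eq product_vector_def case_prod_conv)
  with assms(1) show False unfolding two_coord_sym_kernel by simp
qed

lemma rel_entropy_sym_kernel:
  assumes "\<bar>r\<bar> < 1"
  shows "rel_entropy (two_coord (uniform_spin, sym_kernel r))
           (product_vector uniform_spin uniform_spin) =
         ereal ((1 + r) / 2 * ln (1 + r) + (1 - r) / 2 * ln (1 - r))"
proof -
  let ?\<gamma> = "two_coord (uniform_spin, sym_kernel r)"
  have "0 < ?\<gamma> (s, t)" for s t
    using sym_kernel_pos[OF assms, of s t] by (simp add: uniform_spin_def)
  then have "{b. ?\<gamma> b \<noteq> 0} = UNIV" by (auto simp: less_le)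
  moreover have "(\<Sum>b\<in>UNIV. ?\<gamma> b * ln (?\<gamma> b / product_vector uniform_spin uniform_spin b)) =
      (\<Sum>s\<in>UNIV. \<Sum>t\<in>UNIV. (1 + r * \<psi> s t) / 4 * ln (1 + r * \<psi> s t))"
    unfolding sum_pairs two_coord_sym_kernel
    by (simp add: product_vector_def uniform_spin_def del: distrib_left_numeral distrib_right_numeral)
  ultimately show ?thesis
    by (simp add: rel_entropy_def product_vector_def uniform_spin_def sum_spin field_simps)
qed

lemma binary_entropy_defect_pos:
  fixes r :: real
  assumes "\<bar>r\<bar> < 1" "r \<noteq> 0"
  shows "0 < (1 + r) / 2 * ln (1 + r) + (1 - r) / 2 * ln (1 - r)"
  using mult_ln_ratio_le[of "1 + r" 1] mult_ln_ratio_le[of "1 - r" 1] assms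
  by (auto simp: abs_less_iff)

theorem proposition7p7:
  fixes \<beta> :: real
  assumes "0 \<le> \<beta>"
  shows
    "(\<beta> \<le> 1 \<longrightarrow>
        (uniform_spin, \<lambda>s t. 1 / 2) \<in> nl_equilibrium_pairs full_T (spin_energy \<beta>) \<and>
        nl_equilibrium_pairs full_T (spin_energy \<beta>) // ae_same full_T =
          {ae_same full_T `` {(uniform_spin, \<lambda>s t. 1 / 2)}} \<and>
        (\<forall>s t. two_coord (uniform_spin, \<lambda>s t. 1 / 2) (s, t) = 1 / 4))
     \<and>
     (1 < \<beta> \<longrightarrow>
        (\<exists>!m. 0 < m \<and> m = tanh (\<beta> * m)) \<and>
        0 < magnetization \<beta> \<and> magnetization \<beta> < 1 \<and>
        magnetization \<beta> = tanh (\<beta> * magnetization \<beta>) \<and>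
        (\<forall>\<sigma>\<in>{-1, 1}.
           (uniform_spin, Q_spin \<beta> \<sigma>) \<in> nl_equilibrium_pairs full_T (spin_energy \<beta>)) \<and>
        nl_equilibrium_pairs full_T (spin_energy \<beta>) // ae_same full_T =
          (\<lambda>\<sigma>. ae_same full_T `` {(uniform_spin, Q_spin \<beta> \<sigma>)}) ` {-1, 1} \<and>
        card (nl_equilibrium_pairs full_T (spin_energy \<beta>) // ae_same full_T) = 2 \<and>
        (\<forall>\<sigma>\<in>{-1, 1}.
           (\<forall>s t. \<gamma>_spin \<beta> \<sigma> (s, t) = (1 + \<sigma> * magnetization \<beta> * \<psi> s t) / 4) \<and>
           correlation (\<gamma>_spin \<beta> \<sigma>) = \<sigma> * magnetization \<beta>))
     \<and>
     convergent (pressure_seq full_T (spin_energy \<beta>)) \<and>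
     nl_pressure full_T (spin_energy \<beta>) =
       (if \<beta> \<le> 1 then ln 2
        else ln (2 * cosh (\<beta> * magnetization \<beta>)) - \<beta> / 2 * (magnetization \<beta>)\<^sup>2)
     \<and>
     (1 < \<beta> \<longrightarrow>
        (\<forall>\<sigma>\<in>{-1, 1}.
           (\<forall>s. (\<Sum>t\<in>UNIV. \<gamma>_spin \<beta> \<sigma> (s, t)) = 1 / 2) \<and>
           (\<forall>t. (\<Sum>s\<in>UNIV. \<gamma>_spin \<beta> \<sigma> (s, t)) = 1 / 2) \<and>
           \<not> (\<exists>p\<in>prob_vectors. \<exists>q\<in>prob_vectors. \<gamma>_spin \<beta> \<sigma> = product_vector p q) \<and>
           rel_entropy (\<gamma>_spin \<beta> \<sigma>) (product_vector uniform_spin uniform_spin) =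
             ereal ((1 + magnetization \<beta>) / 2 * ln (1 + magnetization \<beta>) +
                    (1 - magnetization \<beta>) / 2 * ln (1 - magnetization \<beta>)) \<and>
           rel_entropy (\<gamma>_spin \<beta> \<sigma>) (product_vector uniform_spin uniform_spin) > 0))"
proof -
  let ?E = "nl_equilibrium_pairs full_T (spin_energy \<beta>)"
  let ?m = "magnetization \<beta>"
  have low: "sign_change \<beta> 0" if "\<beta> \<le> 1"
    using sign_change_0 assms that by blast
  have E_low: "?E = {(uniform_spin, \<lambda>s t. 1 / 2)}" if "\<beta> \<le> 1"
    using equilibrium_pairs_eq[OF assms low[OF that]]
    by (simp add: sym_kernel_def [abs_def])
  have mag: "0 < ?m \<and> ?m = tanh (\<beta> * ?m)" if "1 < \<beta>"
    unfolding magnetization_def using theI'[OF positive_fixed_point_unique[OF that]] .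
  have mag1: "?m < 1" if "1 < \<beta>"
    using mag[OF that] tanh_real_bounds[of "\<beta> * ?m"] by auto
  have high: "sign_change \<beta> ?m" if "1 < \<beta>"
    using fixed_point_sign_change mag that by blast
  have Q: "Q_spin \<beta> \<sigma> = sym_kernel (\<sigma> * ?m)" for \<sigma>
    by (simp add: Q_spin_def sym_kernel_def fun_eq_iff)
  have \<gamma>: "\<gamma>_spin \<beta> \<sigma> = two_coord (uniform_spin, sym_kernel (\<sigma> * ?m))" for \<sigma>
    by (simp add: \<gamma>_spin_def Q)
  have E_high: "?E = (\<lambda>\<sigma>. (uniform_spin, Q_spin \<beta> \<sigma>)) ` {- 1, 1}" if "1 < \<beta>"
    using equilibrium_pairs_eq[OF assms high[OF that]] by (simp add: Q)
  have quot: "?E // ae_same full_T = (\<lambda>\<sigma>. ae_same full_T `` {(uniform_spin, Q_spin \<beta> \<sigma>)}) ` {- 1, 1}"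
    if "1 < \<beta>"
    unfolding E_high[OF that] by (auto simp: quotient_def)
  have card: "card (?E // ae_same full_T) = 2" if "1 < \<beta>"
  proof -
    have "ae_same full_T `` {(uniform_spin, Q_spin \<beta> (- 1))} \<noteq>
        ae_same full_T `` {(uniform_spin, Q_spin \<beta> 1)}"
    proof
      assume eq: "ae_same full_T `` {(uniform_spin, Q_spin \<beta> (- 1))} =
        ae_same full_T `` {(uniform_spin, Q_spin \<beta> 1)}"
      have "(uniform_spin, Q_spin \<beta> 1) \<in> stationary_pairs full_T"
        using E_high[OF that] by (auto simp: nl_equilibrium_pairs_def)
      from eq_equiv_class[OF eq equiv_ae_same this]
      have "Q_spin \<beta> (- 1) (Spin 1) (Spin 1) = Q_spin \<beta> 1 (Spin 1) (Spin 1)"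
        by (simp add: ae_same_def uniform_spin_def)
      then show False using mag[OF that] by (simp add: Q_spin_def)
    qed
    then show ?thesis unfolding quot[OF that] by simp
  qed
  have lim: "pressure_seq full_T (spin_energy \<beta>) \<longlonglongrightarrow>
      (if \<beta> \<le> 1 then ln 2 else ln (2 * cosh (\<beta> * ?m)) - \<beta> / 2 * ?m\<^sup>2)"
    using pressure_seq_tendsto[OF assms low] pressure_seq_tendsto[OF assms high]
    by (auto simp: mean_field_def)
  have "0 < (1 + ?m) / 2 * ln (1 + ?m) + (1 - ?m) / 2 * ln (1 - ?m)" if "1 < \<beta>"
    using binary_entropy_defect_pos[of ?m] mag[OF that] mag1[OF that] by auto
  moreover have "rel_entropy (\<gamma>_spin \<beta> \<sigma>) (product_vector uniform_spin uniform_spin) =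
      ereal ((1 + ?m) / 2 * ln (1 + ?m) + (1 - ?m) / 2 * ln (1 - ?m))"
    if "1 < \<beta>" "\<sigma> \<in> {- 1, 1}" for \<sigma>
    using rel_entropy_sym_kernel[of "\<sigma> * ?m"] mag[OF that(1)] mag1[OF that(1)] that(2)
    by (auto simp: \<gamma> add.commute)
  moreover have "\<not> (\<exists>p\<in>prob_vectors. \<exists>q\<in>prob_vectors. \<gamma>_spin \<beta> \<sigma> = product_vector p q)"
    if "1 < \<beta>" "\<sigma> \<in> {- 1, 1}" for \<sigma>
    using two_coord_sym_kernel_not_product[of "\<sigma> * ?m"] mag[OF that(1)] that(2)
    by (auto simp: \<gamma>)
  moreover have "?E // ae_same full_T = {ae_same full_T `` {(uniform_spin, \<lambda>s t. 1 / 2)}}"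
    if "\<beta> \<le> 1"
    unfolding E_low[OF that] by (auto simp: quotient_def)
  moreover have "two_coord (uniform_spin, \<lambda>s t. 1 / 2) (s, t) = 1 / 4" for s t
    by (simp add: uniform_spin_def)
  moreover have "(\<forall>s t. \<gamma>_spin \<beta> \<sigma> (s, t) = (1 + \<sigma> * ?m * \<psi> s t) / 4) \<and>
      correlation (\<gamma>_spin \<beta> \<sigma>) = \<sigma> * ?m" for \<sigma>
    unfolding \<gamma> correlation_sym_kernel two_coord_sym_kernel by simp
  moreover have "(\<forall>s. (\<Sum>t\<in>UNIV. \<gamma>_spin \<beta> \<sigma> (s, t)) = 1 / 2) \<and>
      (\<forall>t. (\<Sum>s\<in>UNIV. \<gamma>_spin \<beta> \<sigma> (s, t)) = 1 / 2)" for \<sigma>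
    unfolding \<gamma> two_coord_sym_kernel_marginals by simp
  moreover have "(uniform_spin, \<lambda>s t. 1 / 2) \<in> ?E" if "\<beta> \<le> 1"
    using E_low[OF that] by simp
  moreover have "\<forall>\<sigma>\<in>{- 1, 1}. (uniform_spin, Q_spin \<beta> \<sigma>) \<in> ?E" if "1 < \<beta>"
    unfolding E_high[OF that] by simp
  moreover have "convergent (pressure_seq full_T (spin_energy \<beta>))"
    and "nl_pressure full_T (spin_energy \<beta>) =
      (if \<beta> \<le> 1 then ln 2 else ln (2 * cosh (\<beta> * ?m)) - \<beta> / 2 * ?m\<^sup>2)"
    using lim by (auto simp: convergent_def nl_pressure_def limI)
  ultimately show ?thesis
    using positive_fixed_point_unique mag mag1 quot card by simp
qed

end
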